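(* Let $D_0$ be a diagram with at most one cell in each column. Then $\mathcal{P}(D_0)$ is ranked, with a rank function given by $rk(D)=rowsum(D)-b(D_0)$ for $D\in KD(D_0)$ (equivalently, $rk(D)$ is the number of empty positions lying below cells of $D$ in their columns).
   Context: A diagram is a finite set $D$ of cells $(r,c)$ with $r,c$ positive integers; $r$ is the row (rows numbered from bottom to top starting at 1) and $c$ the column (numbered from left to right starting at 1). A Kohnert move at row $r$ applied to a diagram $D$: if row $r$ of $D$ is empty, $D$ is unchanged; otherwise let $(r,c)$ be the cell of row $r$ with the largest column index; if every position $(r',c)$ with $1\le r'<r$ belongs to $D$, then $D$ is unchanged; otherwise let $r'$ be the largest integer with $1\le r'<r$ and $(r',c)\notin D$, and the move replaces the cell $(r,c)$ by $(r',c)$. For a diagram $D_0$, $KD(D_0)$ is the set of all diagrams obtainable from $D_0$ by finite (possibly empty) sequences of Kohnert moves. The Kohnert poset $\mathcal{P}(D_0)$ is $KD(D_0)$ ordered by $D_2\preceq D_1$ iff $D_2$ can be obtained from $D_1$ by a finite sequence of Kohnert moves; $Min(D_0)$ is its set of minimal elements. For a diagram $D$, $rowsum(D)=\sum_{(r,c)\in D} r$, and $b(D_0)=\min\{rowsum(T): T\in Min(D_0)\}$. A finite poset $P$ is ranked if there is a function $\rho:P\to\mathbb{Z}_{\ge0}$ such that $x\prec y$ implies $\rho(x)<\rho(y)$ and $\rho(y)=\rho(x)+1$ whenever $y$ covers $x$. *)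

theory Defs
  imports Main
begin

text \<open>A cell is a pair (row, column), both numbered from 1; rows are counted from the bottom.\<close>

type_synonym cell = "nat \<times> nat"

definition diagram :: "cell set \<Rightarrow> bool" where
  "diagram D \<longleftrightarrow> finite D \<and> (\<forall>(r, c) \<in> D. 1 \<le> r \<and> 1 \<le> c)"

definition empty_rows_below :: "cell set \<Rightarrow> nat \<Rightarrow> nat \<Rightarrow> nat set" where
  "empty_rows_below D r c = {r'. 1 \<le> r' \<and> r' < r \<and> (r', c) \<notin> D}"

definition kohnert_move :: "nat \<Rightarrow> cell set \<Rightarrow> cell set" where
  "kohnert_move r D =
     (if {c. (r, c) \<in> D} = {} then D
      else let c = Max {c. (r, c) \<in> D} in
        if empty_rows_below D r c = {} then D
        else insert (Max (empty_rows_below D r c), c) (D - {(r, c)}))"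

definition kohnert_step :: "cell set \<Rightarrow> cell set \<Rightarrow> bool" where
  "kohnert_step D D' \<longleftrightarrow> (\<exists>r\<ge>1. D' = kohnert_move r D)"

definition KD :: "cell set \<Rightarrow> cell set set" where
  "KD D0 = {D. kohnert_step\<^sup>*\<^sup>* D0 D}"

text \<open>As usual for order relations, a pair \<open>(x, y)\<close> in the relation means that \<open>x\<close> is below \<open>y\<close>;
  so the diagram obtained by the moves is the first component.\<close>

definition kohnert_order :: "cell set \<Rightarrow> cell set rel" where
  "kohnert_order D0 =
     {(D2, D1). D2 \<in> KD D0 \<and> D1 \<in> KD D0 \<and> kohnert_step\<^sup>*\<^sup>* D1 D2}"

definition minimal_elements :: "'a set \<Rightarrow> 'a rel \<Rightarrow> 'a set" where
  "minimal_elements P le = {x \<in> P. \<forall>y\<in>P. (y, x) \<in> le \<longrightarrow> y = x}"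

definition Min_KD :: "cell set \<Rightarrow> cell set set" where
  "Min_KD D0 = minimal_elements (KD D0) (kohnert_order D0)"

definition rowsum :: "cell set \<Rightarrow> nat" where
  "rowsum D = (\<Sum>(r, c)\<in>D. r)"

definition b_rowsum :: "cell set \<Rightarrow> nat" where
  "b_rowsum D0 = Min (rowsum ` Min_KD D0)"

definition strictly_below :: "'a rel \<Rightarrow> 'a \<Rightarrow> 'a \<Rightarrow> bool" where
  "strictly_below le x y \<longleftrightarrow> (x, y) \<in> le \<and> x \<noteq> y"

definition covers :: "'a set \<Rightarrow> 'a rel \<Rightarrow> 'a \<Rightarrow> 'a \<Rightarrow> bool" where
  "covers P le y x \<longleftrightarrow> strictly_below le x y \<and>
     \<not> (\<exists>z\<in>P. strictly_below le x z \<and> strictly_below le z y)"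

text \<open>Rank functions are integer-valued with explicit nonnegativity on the poset, so that
  differences such as the one in \<open>rk\<close> are not truncated.\<close>

definition rank_function :: "'a set \<Rightarrow> 'a rel \<Rightarrow> ('a \<Rightarrow> int) \<Rightarrow> bool" where
  "rank_function P le \<rho> \<longleftrightarrow>
     (\<forall>x\<in>P. 0 \<le> \<rho> x) \<and>
     (\<forall>x\<in>P. \<forall>y\<in>P. strictly_below le x y \<longrightarrow> \<rho> x < \<rho> y) \<and>
     (\<forall>x\<in>P. \<forall>y\<in>P. covers P le y x \<longrightarrow> \<rho> y = \<rho> x + 1)"

definition ranked_poset :: "'a set \<Rightarrow> 'a rel \<Rightarrow> bool" where
  "ranked_poset P le \<longleftrightarrow>
     finite P \<and> partial_order_on P le \<and> (\<exists>\<rho>. rank_function P le \<rho>)"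

definition rk :: "cell set \<Rightarrow> cell set \<Rightarrow> int" where
  "rk D0 D = int (rowsum D) - int (b_rowsum D0)"

definition empty_positions_below :: "cell set \<Rightarrow> cell set" where
  "empty_positions_below D = {(r', c). \<exists>r. (r, c) \<in> D \<and> r' \<in> empty_rows_below D r c}"

end

(*
  If no column holds two cells, a nontrivial Kohnert move lowers a single cell by exactly one row,
  so it lowers the row sum by exactly one. Hence the row sum is strictly monotone and increases by
  one along covers. A diagram admits no nontrivial move only when all its cells lie in row 1; all
  minimal elements therefore have row sum equal to the number of cells, and subtracting this number
  from the row sum of D counts the positions below its cells, all of which are empty.
*)
theory Submission imports Defs begin

section \<open>Diagrams with at most one cell per column\<close>

definition sparse :: "cell set \<Rightarrow> bool" where
  "sparse D \<longleftrightarrow> diagram D \<and> inj_on snd D"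

lemma sparse_finite: "sparse D \<Longrightarrow> finite D"
  by (simp add: sparse_def diagram_def)

lemma sparse_column_unique: "sparse D \<Longrightarrow> (r, c) \<in> D \<Longrightarrow> (r', c) \<in> D \<Longrightarrow> r' = r"
  unfolding sparse_def inj_on_def by fastforce

lemma sparse_row_pos: "sparse D \<Longrightarrow> (r, c) \<in> D \<Longrightarrow> 1 \<le> r"
  unfolding sparse_def diagram_def by blast

lemma sparseI:
  assumes "diagram D" and "\<forall>c. card {r. (r, c) \<in> D} \<le> 1"
  shows "sparse D"
proof -
  have "finite D" using assms(1) by (simp add: diagram_def)
  have "r = r'" if "(r, c) \<in> D" "(r', c) \<in> D" for r r' c
  proof -
    \<comment> \<open>An infinite set has \<open>card\<close> 0 and would meet the bound vacuously,
      so finiteness of the column must come first.\<close>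
    have "finite {r. (r, c) \<in> D}"
      by (rule finite_subset[OF _ finite_imageI[OF \<open>finite D\<close>, of fst]]) force
    then show ?thesis
      using assms(2) that card_le_Suc0_iff_eq[of "{r. (r, c) \<in> D}"] by auto
  qed
  then show ?thesis
    using assms(1) by (auto simp: sparse_def inj_on_def)
qed

section \<open>Kohnert moves on sparse diagrams\<close>

lemma sparse_empty_rows_below:
  assumes "sparse D" "(r, c) \<in> D"
  shows "empty_rows_below D r c = {1..<r}"
  using sparse_column_unique[OF assms] by (fastforce simp: empty_rows_below_def)

text \<open>The moved cell stands in the rightmost occupied column \<open>c'\<close> of row
  \<open>r\<close>, which may differ from \<open>c\<close>; the given cell only shows that the row
  is nonempty. Since all positions below the moved cell are free, the highest one is directly
  beneath it.\<close>

lemma kohnert_move_sparse: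
  assumes "sparse D" "(r, c) \<in> D" "2 \<le> r"
  obtains c' where "(r, c') \<in> D" "kohnert_move r D = insert (r - 1, c') (D - {(r, c')})"
proof
  let ?C = "{c. (r, c) \<in> D}"
  have "finite ?C"
    by (rule finite_subset[OF _ finite_imageI[OF sparse_finite[OF assms(1)], of snd]]) force
  moreover have "?C \<noteq> {}" using assms by auto
  ultimately show m: "(r, Max ?C) \<in> D" using Max_in by blast
  have "Max {1..<r} = r - 1"
    using assms(3) by (intro Max_eqI) auto
  moreover have "{1..<r} \<noteq> {}" using assms(3) by simp
  ultimately show "kohnert_move r D = insert (r - 1, Max ?C) (D - {(r, Max ?C)})"
    using \<open>?C \<noteq> {}\<close> unfolding kohnert_move_def
    by (simp only: Let_def sparse_empty_rows_below[OF assms(1) m] if_False)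
qed

lemma kohnert_move_bottom_row:
  "kohnert_move 1 D = D"
proof -
  have "empty_rows_below D 1 c = {}" for c
    by (auto simp: empty_rows_below_def)
  then show ?thesis by (simp add: kohnert_move_def Let_def)
qed

text \<open>A step may be idle: the chosen row can be empty or the bottom one. Any other row has a
  cell that can descend.\<close>

lemma kohnert_step_cases:
  assumes "sparse D" "kohnert_step D D'"
  obtains "D' = D"
  | r c where "2 \<le> r" "(r, c) \<in> D" "D' = insert (r - 1, c) (D - {(r, c)})"
proof -
  obtain r where r: "r \<ge> 1" "D' = kohnert_move r D"
    using assms(2) by (auto simp: kohnert_step_def)
  show ?thesis
  proof (cases "r = 1 \<or> {c. (r, c) \<in> D} = {}")
    case True
    then have "kohnert_move r D = D"
    proof
      assume "r = 1"
      then show ?thesis by (simp only: kohnert_move_bottom_row)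
    next
      assume "{c. (r, c) \<in> D} = {}"
      then show ?thesis by (simp add: kohnert_move_def)
    qed
    then show ?thesis using r(2) by (intro that(1)) simp
  next
    case False
    then obtain c where "(r, c) \<in> D" by blast
    moreover have "2 \<le> r" using False r by simp
    ultimately show ?thesis
      using that(2) kohnert_move_sparse[OF assms(1)] r(2) by metis
  qed
qed

text \<open>The moved cell stays in its own column, which holds no other cell. Hence no columns
  merge, and only one summand of the row sum changes, by one.\<close>

lemma kohnert_step_sparse:
  assumes "sparse D" "kohnert_step D D'" "D' \<noteq> D"
  shows "sparse D'" "snd ` D' = snd ` D" "rowsum D = Suc (rowsum D')"
proof -
  obtain r c where rc: "2 \<le> r" "(r, c) \<in> D" and D': "D' = insert (r - 1, c) (D - {(r, c)})"
    using kohnert_step_cases[OF assms(1,2)] assms(3) by metis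
  have fin: "finite D" using assms(1) by (rule sparse_finite)
  have unique: "(r', c) \<notin> D - {(r, c)}" for r'
    using sparse_column_unique[OF assms(1) rc(2)] by blast
  have "diagram D'"
  proof -
    have "finite D'" using fin by (simp add: D')
    moreover have "1 \<le> c" "1 \<le> r - 1"
      using assms(1) rc by (auto simp: sparse_def diagram_def)
    ultimately show ?thesis
      using assms(1) by (simp add: sparse_def diagram_def D')
  qed
  moreover have "inj_on snd D'"
  proof -
    have "inj_on snd (D - {(r, c)})"
      using assms(1) unfolding sparse_def by (blast intro: inj_on_diff)
    \<comment> \<open>The second set difference is there to match the form of
      \<open>inj_on_insert\<close>.\<close>
    moreover have "c \<notin> snd ` (D - {(r, c)} - {(r - 1, c)})"
    proof
      assume "c \<in> snd ` (D - {(r, c)} - {(r - 1, c)})"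
      then obtain r' where "(r', c) \<in> D - {(r, c)}" by (elim imageE) (metis DiffD1 prod.collapse)
      then show False using unique by blast
    qed
    ultimately show ?thesis by (simp only: D' inj_on_insert snd_conv simp_thms)
  qed
  ultimately show "sparse D'" by (simp add: sparse_def)
  show "snd ` D' = snd ` D"
    unfolding D' using rc(2) by force
  have "rowsum D = r + (\<Sum>(r, c)\<in>D - {(r, c)}. r)"
    unfolding rowsum_def using sum.remove[OF fin rc(2), of "\<lambda>(r, c). r"] by simp
  moreover have "rowsum D' = (r - 1) + (\<Sum>(r, c)\<in>D - {(r, c)}. r)"
    unfolding rowsum_def D' using unique[of "r - 1"] fin by simp
  ultimately show "rowsum D = Suc (rowsum D')"
    using rc(1) by simp
qed

text \<open>Idle steps keep the row sum and all others lower it, so a chain that returns to its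
  starting row sum has never left its starting diagram.\<close>

lemma kohnert_steps_sparse:
  assumes "kohnert_step\<^sup>*\<^sup>* D D'" "sparse D"
  shows "sparse D' \<and> snd ` D' = snd ` D \<and> (D' = D \<or> rowsum D' < rowsum D)"
  using assms
proof (induction rule: rtranclp_induct)
  case (step D' D'')
  show ?case
  proof (cases "D'' = D'")
    case False
    have IH: "sparse D'" "snd ` D' = snd ` D" "rowsum D' \<le> rowsum D"
      using step.IH[OF step.prems] by auto
    show ?thesis
      using kohnert_step_sparse[OF IH(1) step.hyps(2) False] IH(2,3) by simp
  next
    case True
    show ?thesis unfolding True by (rule step.IH[OF step.prems])
  qed
qed simp

section \<open>Invariants and finiteness of \<open>KD\<close>\<close>

lemma sparse_KD:
  "sparse D0 \<Longrightarrow> D \<in> KD D0 \<Longrightarrow> sparse D"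
  "sparse D0 \<Longrightarrow> D \<in> KD D0 \<Longrightarrow> snd ` D = snd ` D0"
  "sparse D0 \<Longrightarrow> D \<in> KD D0 \<Longrightarrow> rowsum D \<le> rowsum D0"
  using kohnert_steps_sparse[of D0 D] by (auto simp: KD_def)

lemma card_KD:
  assumes "sparse D0" "D \<in> KD D0"
  shows "card D = card D0"
  using sparse_KD(1,2)[OF assms] assms(1) unfolding sparse_def by (metis card_image)

lemma row_le_rowsum:
  assumes "finite D" "(r, c) \<in> D"
  shows "r \<le> rowsum D"
  using member_le_sum[of "(r, c)" D "\<lambda>(r, c). r"] assms by (simp add: rowsum_def)

text \<open>Every reachable diagram fits in one finite box: its columns are those of
  \<open>D0\<close>, and each row index is bounded by a row sum that never grows.\<close>

lemma finite_KD:
  assumes "sparse D0"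
  shows "finite (KD D0)"
proof (rule finite_subset)
  show "KD D0 \<subseteq> Pow ({..rowsum D0} \<times> snd ` D0)"
  proof (intro subsetI PowI)
    fix D x assume D: "D \<in> KD D0" and x: "x \<in> D"
    have "snd x \<in> snd ` D0"
      using sparse_KD(2)[OF assms D] x by blast
    moreover have "fst x \<le> rowsum D0"
      using row_le_rowsum[of D "fst x" "snd x"] sparse_KD(1,3)[OF assms D] sparse_finite x
      by fastforce
    ultimately show "x \<in> {..rowsum D0} \<times> snd ` D0"
      by (cases x) auto
  qed
  show "finite (Pow ({..rowsum D0} \<times> snd ` D0))"
    using sparse_finite[OF assms] by simp
qed

section \<open>The Kohnert order and its covers\<close>

lemma strictly_below_kohnert_order_rowsum:
  assumes "sparse D0" "strictly_below (kohnert_order D0) x y"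
  shows "rowsum x < rowsum y"
  using assms kohnert_steps_sparse[of y x] sparse_KD(1)[OF assms(1), of y]
  by (auto simp: strictly_below_def kohnert_order_def)

lemma partial_order_on_kohnert_order:
  assumes "sparse D0"
  shows "partial_order_on (KD D0) (kohnert_order D0)"
proof -
  have "antisym (kohnert_order D0)"
  proof (rule antisymI, rule ccontr)
    fix x y assume "(x, y) \<in> kohnert_order D0" "(y, x) \<in> kohnert_order D0" "x \<noteq> y"
    then have "rowsum x < rowsum y" "rowsum y < rowsum x"
      by (simp_all add: strictly_below_kohnert_order_rowsum[OF assms] strictly_below_def)
    then show False by simp
  qed
  moreover have "kohnert_order D0 \<subseteq> KD D0 \<times> KD D0" "refl_on (KD D0) (kohnert_order D0)"
    by (auto simp: kohnert_order_def refl_on_def)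
  moreover have "trans (kohnert_order D0)"
    by (rule transI) (auto simp: kohnert_order_def)
  ultimately show ?thesis
    by (simp add: partial_order_on_def preorder_on_def)
qed

text \<open>The first effective step on a chain from \<open>y\<close> to \<open>x\<close> reaches
  some \<open>z\<close> strictly below \<open>y\<close> and weakly above \<open>x\<close>. Covering
  forces \<open>z = x\<close>, so a single effective step separates the two.\<close>

lemma covers_kohnert_order_rowsum:
  assumes "sparse D0" "covers (KD D0) (kohnert_order D0) y x"
  shows "rowsum y = Suc (rowsum x)"
proof -
  have y: "y \<in> KD D0" and x: "x \<in> KD D0" and "x \<noteq> y" and yx: "kohnert_step\<^sup>*\<^sup>* y x"
    using assms(2) by (auto simp: covers_def strictly_below_def kohnert_order_def)
  have "\<exists>z. kohnert_step y z \<and> z \<noteq> y \<and> kohnert_step\<^sup>*\<^sup>* z x"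
    using yx \<open>x \<noteq> y\<close>
  proof (induction rule: converse_rtranclp_induct)
    case (step y z)
    \<comment> \<open>An idle first step is skipped by the induction hypothesis; otherwise
      \<open>z\<close> itself is the witness.\<close>
    then show ?case by (cases "z = y") auto
  qed simp
  then obtain z where z: "kohnert_step y z" "z \<noteq> y" "kohnert_step\<^sup>*\<^sup>* z x"
    by blast
  have "z \<in> KD D0"
    using y z(1) by (auto simp: KD_def)
  then have "z = x"
    using assms(2) x y z
    by (auto simp: covers_def strictly_below_def kohnert_order_def)
  then show ?thesis
    using kohnert_step_sparse(3)[OF sparse_KD(1)[OF assms(1) y] z(1,2)] by simp
qed

section \<open>Minimal elements and the value of \<open>b_rowsum\<close>\<close>

lemma rowsum_Min_KD:
  assumes "sparse D0" "T \<in> Min_KD D0"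
  shows "rowsum T = card D0"
proof -
  have T: "T \<in> KD D0" and min: "\<And>y. y \<in> KD D0 \<Longrightarrow> kohnert_step\<^sup>*\<^sup>* T y \<Longrightarrow> y = T"
    using assms(2) by (auto simp: Min_KD_def minimal_elements_def kohnert_order_def)
  note sT = sparse_KD(1)[OF assms(1) T]
  \<comment> \<open>A cell above row 1 would allow an effective move. By minimality its result
    equals \<open>T\<close>, which would then hold two cells in column \<open>c'\<close>.\<close>
  have "fst x = 1" if "x \<in> T" for x
  proof (rule ccontr)
    obtain r c where x: "x = (r, c)" by fastforce
    with that have rc: "(r, c) \<in> T" by simp
    assume "fst x \<noteq> 1"
    then have "r \<noteq> 1" using x by simp
    then have r: "2 \<le> r" using sparse_row_pos[OF sT rc] by simp
    then obtain c' where c': "(r, c') \<in> T"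
        "kohnert_move r T = insert (r - 1, c') (T - {(r, c')})"
      using kohnert_move_sparse[OF sT rc] by metis
    have step: "kohnert_step T (kohnert_move r T)"
      using r unfolding kohnert_step_def by (metis one_le_numeral order_trans)
    then have "kohnert_move r T \<in> KD D0"
      using T by (auto simp: KD_def)
    then have "kohnert_move r T = T"
      using min step by blast
    then have "(r - 1, c') \<in> T" using c'(2) by blast
    then have "r - 1 = r"
      by (rule sparse_column_unique[OF sT c'(1)])
    then show False using r by simp
  qed
  then have "rowsum T = (\<Sum>x\<in>T. 1)"
    unfolding rowsum_def by (intro sum.cong) auto
  then show ?thesis
    using card_KD[OF assms(1) T] by simp
qed

text \<open>Needed because \<open>b_rowsum\<close> is a \<open>Min\<close>, unspecified on the empty
  set. A diagram of least row sum is minimal, since going strictly down lowers the row sum.\<close>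

lemma Min_KD_nonempty:
  assumes "sparse D0"
  shows "Min_KD D0 \<noteq> {}"
proof -
  have "D0 \<in> KD D0" by (simp add: KD_def)
  then obtain T where T: "T \<in> KD D0" "\<And>D. D \<in> KD D0 \<Longrightarrow> rowsum T \<le> rowsum D"
    using exists_least_iff[of "\<lambda>n. \<exists>D\<in>KD D0. rowsum D = n"] by (metis not_le)
  have "y = T" if "y \<in> KD D0" "(y, T) \<in> kohnert_order D0" for y
    using strictly_below_kohnert_order_rowsum[OF assms, of y T] T(2)[OF that(1)] that(2)
    by (auto simp: strictly_below_def)
  then have "T \<in> Min_KD D0"
    using T(1) by (auto simp: Min_KD_def minimal_elements_def)
  then show ?thesis by blast
qed

lemma b_rowsum_sparse:
  assumes "sparse D0"
  shows "b_rowsum D0 = card D0"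
proof -
  have "rowsum ` Min_KD D0 = {card D0}"
    using rowsum_Min_KD[OF assms] Min_KD_nonempty[OF assms] by auto
  then show ?thesis by (simp add: b_rowsum_def)
qed

section \<open>Counting empty positions\<close>

lemma card_empty_positions_below:
  assumes "sparse D"
  shows "card (empty_positions_below D) + card D = rowsum D"
proof -
  let ?B = "\<lambda>x. {1..<fst x} \<times> {snd x}"
  have "empty_positions_below D = (\<Union>x\<in>D. ?B x)"
    unfolding empty_positions_below_def
    using sparse_empty_rows_below[OF assms] by fastforce
  \<comment> \<open>The blocks are disjoint because distinct cells have distinct columns.\<close>
  moreover have "card (\<Union>x\<in>D. ?B x) = (\<Sum>x\<in>D. card (?B x))"
    using assms by (intro card_UN_disjoint) (auto simp: sparse_finite dest: sparse_column_unique)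
  \<comment> \<open>Each cell contributes the 1 that its block lacks; as rows start at 1, the
    truncated subtraction is then undone.\<close>
  ultimately have "card (empty_positions_below D) + card D = (\<Sum>x\<in>D. (fst x - 1) + 1)"
    by (simp add: card_cartesian_product sum_Suc)
  also have "\<dots> = rowsum D"
    unfolding rowsum_def using sparse_row_pos[OF assms] by (intro sum.cong) fastforce+
  finally show ?thesis .
qed

lemma rk_sparse:
  assumes "sparse D0" "D \<in> KD D0"
  shows "rk D0 D = int (card (empty_positions_below D))"
  using card_empty_positions_below[OF sparse_KD(1)[OF assms]] b_rowsum_sparse[OF assms(1)]
    card_KD[OF assms]
  by (simp add: rk_def)

theorem theorem4p4:
  fixes D0 :: "cell set"
  assumes "diagram D0"
    and "\<forall>c. card {r. (r, c) \<in> D0} \<le> 1"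
  shows "ranked_poset (KD D0) (kohnert_order D0)
    \<and> rank_function (KD D0) (kohnert_order D0) (rk D0)
    \<and> (\<forall>D \<in> KD D0. rk D0 D = int (card (empty_positions_below D)))"
proof -
  have D0: "sparse D0" using assms by (rule sparseI)
  have "rank_function (KD D0) (kohnert_order D0) (rk D0)"
    unfolding rank_function_def
  proof (intro conjI ballI impI)
    \<comment> \<open>As a cardinality, the rank cannot be negative.\<close>
    show "0 \<le> rk D0 x" if "x \<in> KD D0" for x
      using rk_sparse[OF D0 that] by simp
    show "rk D0 x < rk D0 y" if "strictly_below (kohnert_order D0) x y" for x y
      using strictly_below_kohnert_order_rowsum[OF D0 that] by (simp add: rk_def)
    show "rk D0 y = rk D0 x + 1" if "covers (KD D0) (kohnert_order D0) y x" for x y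
      using covers_kohnert_order_rowsum[OF D0 that] by (simp add: rk_def)
  qed
  then show ?thesis
    using finite_KD[OF D0] partial_order_on_kohnert_order[OF D0] rk_sparse[OF D0]
    by (auto simp: ranked_poset_def)
qed

end
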